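(* Let $q,s\ge 1$ be integers and let $\mathbf{t}=(t_1,\dots,t_q)\in\mathbb{N}_+^q$. If $n\ge\|\mathbf{t}\|_\infty+\Lambda_\mathbf{t}+1+7(q+1)(s-1)$ and $G$ is an $n$-vertex $s$-connector, then $G\to \mathbf{t} K_2$, i.e. for every colouring of the edges of $G$ with colours $1,\dots,q$ there is some $j\in[q]$ such that the edges of colour $j$ contain a matching of size $t_j$.
   Context: $\mathbb{N}_+$ denotes the positive integers and $[q]=\{1,\dots,q\}$. A graph $G=(V,E)$ is an $s$-connector if $E$ contains an edge between $X$ and $Y$ for every pair of disjoint sets $X,Y\subseteq V$ with $|X|,|Y|\ge s$. For $\mathbf{t}\in\mathbb{N}_+^q$, $\|\mathbf{t}\|_\infty=\max_j t_j$ and $\Lambda_\mathbf{t}=\sum_{i=1}^q(t_i-1)$. We write $G\to\mathbf{t}K_2$ if every $q$-edge-colouring of $G$ contains, for some $j\in[q]$, a matching of size $t_j$ all of whose edges have colour $j$. *)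

theory Defs
  imports Main
begin

(* A graph is a pair of a vertex set V and an edge set E of unordered pairs {x, y}.
   A tuple (t_1, ..., t_q) is a function t, of which only the values on {1..q} matter. *)

definition simple_graph :: "'a set \<Rightarrow> 'a set set \<Rightarrow> bool" where
  "simple_graph V E \<longleftrightarrow> finite V \<and> (\<forall>e\<in>E. e \<subseteq> V \<and> card e = 2)"

definition connector :: "nat \<Rightarrow> 'a set \<Rightarrow> 'a set set \<Rightarrow> bool" where
  "connector s V E \<longleftrightarrow>
     (\<forall>X Y. X \<subseteq> V \<longrightarrow> Y \<subseteq> V \<longrightarrow> X \<inter> Y = {} \<longrightarrow> s \<le> card X \<longrightarrow> s \<le> card Y
        \<longrightarrow> (\<exists>x\<in>X. \<exists>y\<in>Y. {x, y} \<in> E))"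

definition matching :: "'a set set \<Rightarrow> 'a set set \<Rightarrow> bool" where
  "matching E M \<longleftrightarrow> M \<subseteq> E \<and> pairwise disjnt M"

definition edge_colouring :: "nat \<Rightarrow> 'a set set \<Rightarrow> ('a set \<Rightarrow> nat) \<Rightarrow> bool" where
  "edge_colouring q E c \<longleftrightarrow> (\<forall>e\<in>E. c e \<in> {1..q})"

definition arrows_matchings :: "'a set set \<Rightarrow> nat \<Rightarrow> (nat \<Rightarrow> nat) \<Rightarrow> bool" where
  "arrows_matchings E q t \<longleftrightarrow>
     (\<forall>c. edge_colouring q E c \<longrightarrow>
        (\<exists>j\<in>{1..q}. \<exists>M. matching E M \<and> card M = t j \<and> (\<forall>e\<in>M. c e = j)))"

(* Used only for q \<ge> 1, where the maximum is over a nonempty set. *)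
definition max_norm :: "nat \<Rightarrow> (nat \<Rightarrow> nat) \<Rightarrow> nat" where
  "max_norm q t = Max (t ` {1..q})"

(* Used only for positive entries t i, where the subtraction on nat does not truncate. *)
definition Lambda :: "nat \<Rightarrow> (nat \<Rightarrow> nat) \<Rightarrow> nat" where
  "Lambda q t = (\<Sum>i=1..q. (t i - 1))"

end

(* By the Tutte-Berge formula, a colour class without a matching of size t_j has a vertex set S_j
   such that every edge of colour j avoiding S_j lies in one of a family of blocks C, with
   |S_j| + sum |C| div 2 \<le> t_j - 1. Delete all S_j. Split the remaining vertices into two sides
   X and Y, and from each block delete its smaller half, X \<inter> C or Y \<inter> C. This costs at most
   sum |C| div 2 vertices and leaves no edge between the two sides. Moving vertices one at a time
   from Y to X, and switching the halves deleted from the blocks one at a time (which is free when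
   the moving vertex is put aside), changes the sizes so gradually that at some moment both sides
   have at least s vertices, contradicting the connector property. *)

theory Submission
  imports Defs
begin

section \<open>Maximum matchings and the Tutte--Berge formula\<close>

definition maximum_matching :: "'a set set \<Rightarrow> 'a set set \<Rightarrow> bool" where
  "maximum_matching E M \<longleftrightarrow> matching E M \<and> (\<forall>N. matching E N \<longrightarrow> card N \<le> card M)"

lemma simple_graph_finite:
  assumes "simple_graph V E"
  shows "finite V" "finite E"
proof -
  show "finite V"
    using assms by (simp add: simple_graph_def)
  moreover have "E \<subseteq> Pow V"
    using assms by (auto simp: simple_graph_def)
  ultimately show "finite E"
    by (meson finite_Pow_iff finite_subset)
qed

lemma matching_finite:
  assumes "simple_graph V E" "matching E M"
  shows "finite M"
  using assms simple_graph_finite(2) finite_subset unfolding matching_def by blast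

lemma card_Union_matching:
  assumes "simple_graph V E" "matching E M"
  shows "card (\<Union>M) = 2 * card M"
proof -
  have 2: "card e = 2" if "e \<in> M" for e
    using that assms by (auto simp: simple_graph_def matching_def)
  have "card (\<Union>M) = sum card M"
  proof (rule card_Union_disjoint)
    show "pairwise disjnt M"
      using assms by (simp add: matching_def)
    show "finite e" if "e \<in> M" for e
      using 2[OF that] card.infinite by fastforce
  qed
  then show ?thesis
    using 2 by simp
qed

lemma matching_insert:
  assumes "matching E M" "e \<in> E" "e \<inter> \<Union>M = {}"
  shows "matching E (insert e M)"
  using assms by (auto simp: matching_def pairwise_insert disjnt_def)

lemma matching_subset:
  assumes "matching E M" "N \<subseteq> M"
  shows "matching E N"
  using assms by (auto simp: matching_def intro: pairwise_subset)

lemma maximum_matching_exists: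
  assumes "simple_graph V E"
  obtains M where "maximum_matching E M"
proof -
  have "card M < Suc (card E)" if "matching E M" for M
    using that simple_graph_finite(2)[OF assms] by (auto simp: matching_def less_Suc_eq_le intro: card_mono)
  moreover have "matching E {}"
    by (simp add: matching_def)
  ultimately have "\<exists>M. matching E M \<and> (\<forall>N. matching E N \<longrightarrow> card N \<le> card M)"
    using ex_has_greatest_nat[of "matching E" "{}" card "Suc (card E)"] by blast
  then show thesis
    using that unfolding maximum_matching_def by blast
qed

lemma maximum_matching_meets_edge:
  assumes "simple_graph V E" "maximum_matching E M" "e \<in> E"
  shows "e \<inter> \<Union>M \<noteq> {}"
proof
  assume disj: "e \<inter> \<Union>M = {}"
  have "e \<noteq> {}"
    using assms(1,3) by (auto simp: simple_graph_def)
  then have "e \<notin> M"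
    using disj by blast
  moreover have "finite M"
    using assms matching_finite by (auto simp: maximum_matching_def)
  ultimately have "card (insert e M) = Suc (card M)"
    by simp
  moreover have "matching E (insert e M)"
    using assms disj by (intro matching_insert) (auto simp: maximum_matching_def)
  ultimately show False
    using assms(2) by (force simp: maximum_matching_def)
qed

text \<open>Gallai's lemma, phrased so that no connectivity is needed: if every vertex is missed by
  some maximum matching, then ``no maximum matching misses both'' is a transitive relation.\<close>
lemma gallai_exchange:
  assumes G: "simple_graph V E"
    and M: "maximum_matching E M" "u \<notin> \<Union>M" "v \<notin> \<Union>M" "u \<noteq> v"
    and t: "maximum_matching E N0" "t \<notin> \<Union>N0"
  shows "\<exists>N. maximum_matching E N \<and> t \<notin> \<Union>N \<and> (u \<notin> \<Union>N \<or> v \<notin> \<Union>N)"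
proof (rule ccontr)
  assume neg: "\<not> ?thesis"
  have mM: "matching E M"
    using M by (simp add: maximum_matching_def)
  have finM: "finite M"
    using matching_finite[OF G mM] .
  \<comment> \<open>Among the maximum matchings missing \<open>t\<close>, take one sharing as many
    edges with \<open>M\<close> as possible; the rest of the proof constructs one sharing
    more.\<close>
  obtain N where N: "maximum_matching E N" "t \<notin> \<Union>N"
    and best: "\<And>N'. maximum_matching E N' \<Longrightarrow> t \<notin> \<Union>N' \<Longrightarrow> card (M \<inter> N') \<le> card (M \<inter> N)"
    using ex_has_greatest_nat[of "\<lambda>N. maximum_matching E N \<and> t \<notin> \<Union>N" N0 "\<lambda>N. card (M \<inter> N)" "Suc (card M)"]
      t card_mono[OF finM] by (metis Int_lower1 less_Suc_eq_le)
  have mN: "matching E N"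
    using N by (simp add: maximum_matching_def)
  have finN: "finite N"
    using matching_finite[OF G mN] .
  have same: "card M = card N"
    using M(1) N(1) by (simp add: maximum_matching_def order_antisym)
  have finU: "finite (\<Union>M)" "finite (\<Union>N)"
    using mM mN G by (auto simp: matching_def simple_graph_def intro!: finite_subset[of _ V])
  \<comment> \<open>By \<open>neg\<close>, \<open>N\<close> covers both \<open>u\<close> and
    \<open>v\<close>, which \<open>M\<close> misses. The two matchings cover equally many vertices,
    so \<open>M\<close> covers at least two vertices missed by \<open>N\<close>, and one of them
    differs from \<open>t\<close>.\<close>
  have uv: "{u, v} \<subseteq> \<Union>N - \<Union>M"
    using neg N M by blast
  have "card (\<Union>M - \<Union>N) = card (\<Union>N - \<Union>M)"
    using card_Union_matching[OF G mM] card_Union_matching[OF G mN] same finU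
      card_Int_Diff[of "\<Union>M" "\<Union>N"] card_Int_Diff[of "\<Union>N" "\<Union>M"]
    by (simp add: Int_commute)
  moreover have "2 \<le> card (\<Union>N - \<Union>M)"
    using card_mono[OF _ uv] finU M(4) by simp
  ultimately have "\<not> \<Union>M - \<Union>N \<subseteq> {t}"
    using card_mono[of "{t}" "\<Union>M - \<Union>N"] by auto
  then obtain x e where x: "x \<in> e" "e \<in> M" "x \<notin> \<Union>N" "x \<noteq> t"
    by blast
  have "e \<in> E"
    using mM x by (auto simp: matching_def)
  then have "card e = 2"
    using G by (auto simp: simple_graph_def)
  then obtain y where e: "e = {x, y}"
    using x(1) by (auto simp: card_2_iff)
  have "e \<inter> \<Union>N \<noteq> {}"
    using maximum_matching_meets_edge[OF G N(1) \<open>e \<in> E\<close>] .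
  then obtain f where f: "f \<in> N" "y \<in> f"
    using e x by blast
  have "f \<noteq> e"
    using f x by blast
  moreover have "y \<in> f \<inter> e"
    using f(2) e by simp
  ultimately have "f \<notin> M"
    using mM x(2) pairwiseD[of disjnt M f e] by (auto simp: matching_def disjnt_def)
  have "e \<notin> N"
    using x by blast
  \<comment> \<open>Swapping \<open>f\<close> for \<open>e\<close> keeps the size. The new matching
    still misses \<open>t\<close>, because \<open>x\<close> differs from \<open>t\<close> and
    \<open>y\<close> is covered by \<open>N\<close>, and it shares one more edge with
    \<open>M\<close>.\<close>
  let ?N = "insert e (N - {f})"
  have "y \<notin> \<Union>(N - {f})"
    using mN f by (auto simp: matching_def pairwise_def disjnt_def)
  then have "matching E ?N"
    using matching_subset[OF mN, of "N - {f}"] \<open>e \<in> E\<close> e x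
    by (intro matching_insert) auto
  moreover have "card ?N = card N"
    using finN f(1) \<open>e \<notin> N\<close> by (metis Diff_iff card_Suc_Diff1 card_insert_disjoint finite_Diff)
  ultimately have "maximum_matching E ?N"
    using N(1) by (simp add: maximum_matching_def)
  moreover have "t \<notin> \<Union>?N"
    using N(2) f e x by blast
  ultimately have "card (M \<inter> ?N) \<le> card (M \<inter> N)"
    by (rule best)
  moreover have "M \<inter> ?N = insert e (M \<inter> N)"
    using x(2) \<open>f \<notin> M\<close> by blast
  ultimately show False
    using finM \<open>e \<notin> N\<close> by simp
qed

text \<open>The blocks are the classes of the relation "no maximum matching misses both". Edges stay
  within a class, and \<open>M\<close> misses at most one vertex of each class \<open>C\<close>, so
  at least \<open>card C div 2\<close> edges of \<open>M\<close> lie inside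
  \<open>C\<close>.\<close>

lemma tutte_berge_all_missed:
  assumes G: "simple_graph V E" and M: "maximum_matching E M"
    and miss: "\<And>v. v \<in> V \<Longrightarrow> \<exists>N. maximum_matching E N \<and> v \<notin> \<Union>N"
  shows "\<exists>P. finite P \<and> (\<forall>C\<in>P. C \<subseteq> V) \<and> (\<forall>e\<in>E. \<exists>C\<in>P. e \<subseteq> C)
           \<and> (\<Sum>C\<in>P. card C div 2) \<le> card M"
proof -
  \<comment> \<open>The disjunct \<open>u = v\<close> supplies reflexivity: by \<open>miss\<close>,
    the second disjunct always fails for equal vertices.\<close>
  define R where "R = {(u, v). u \<in> V \<and> v \<in> V \<and>
    (u = v \<or> \<not> (\<exists>N. maximum_matching E N \<and> u \<notin> \<Union>N \<and> v \<notin> \<Union>N))}"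
  have "trans R"
  proof (rule transI)
    fix u w v
    assume "(u, w) \<in> R" "(w, v) \<in> R"
    \<comment> \<open>A maximum matching missing distinct \<open>u\<close> and \<open>v\<close>
      could be exchanged for one missing \<open>w\<close> together with \<open>u\<close> or
      \<open>v\<close>, contradicting one of the two given relations.\<close>
    then show "(u, v) \<in> R"
      using gallai_exchange[OF G, of _ u v _ w] miss[of w] unfolding R_def
      by (smt (verit) case_prodI case_prodD mem_Collect_eq)
  qed
  then have eq: "equiv V R"
    by (intro equivI) (auto simp: refl_on_def sym_def R_def)
  let ?P = "V // R"
  have finV: "finite V"
    using simple_graph_finite(1)[OF G] .
  have sub: "C \<subseteq> V" if "C \<in> ?P" for C
    using that eq by (metis Union_quotient Union_upper)
  have finP: "finite ?P"
    by (rule finite_subset[of _ "Pow V"]) (use sub finV in auto)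
  have edge: "e \<subseteq> C" if "e \<in> E" "C \<in> ?P" "e \<inter> C \<noteq> {}" for e C
  proof -
    have "e \<subseteq> V" "card e = 2"
      using G that by (auto simp: simple_graph_def)
    moreover from this obtain a b where e: "e = {a, b}"
      by (auto simp: card_2_iff)
    ultimately have "(a, b) \<in> R" "(b, a) \<in> R"
      using maximum_matching_meets_edge[OF G _ \<open>e \<in> E\<close>] by (auto simp: R_def)
    then show ?thesis
      using e that(2,3) in_quotient_imp_closed[OF eq that(2)] by blast
  qed
  have cover: "\<exists>C\<in>?P. e \<subseteq> C" if "e \<in> E" for e
  proof -
    have "e \<subseteq> V" "e \<noteq> {}"
      using G that by (auto simp: simple_graph_def)
    then have "e \<inter> \<Union>?P \<noteq> {}"
      using Union_quotient[OF eq] by auto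
    then show ?thesis
      using edge[OF that] by blast
  qed
  have mM: "matching E M"
    using M by (simp add: maximum_matching_def)
  have finM: "finite M"
    using matching_finite[OF G mM] .
  let ?M = "\<lambda>C. {e \<in> M. e \<subseteq> C}"
  have half: "card C div 2 \<le> card (?M C)" if C: "C \<in> ?P" for C
  proof -
    have finC: "finite C"
      using sub[OF C] finV finite_subset by blast
    have "u = v" if "u \<in> C - \<Union>M" "v \<in> C - \<Union>M" for u v
    proof -
      have "(u, v) \<in> R"
        using that quotient_eq_iff[OF eq C C, of u v] by blast
      then show ?thesis
        using that M by (auto simp: R_def)
    qed
    then have "card (C - \<Union>M) \<le> 1"
      using finC by (auto simp: card_le_Suc0_iff_eq)
    moreover have "C \<inter> \<Union>M = \<Union>(?M C)"
      using edge[OF _ C] mM by (fastforce simp: matching_def)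
    moreover have "card (\<Union>(?M C)) = 2 * card (?M C)"
      using card_Union_matching[OF G] matching_subset[OF mM] by (metis (no_types, lifting) mem_Collect_eq subsetI)
    ultimately show ?thesis
      using card_Int_Diff[OF finC, of "\<Union>M"] by simp
  qed
  have "(\<Sum>C\<in>?P. card C div 2) \<le> (\<Sum>C\<in>?P. card (?M C))"
    using half by (rule sum_mono)
  also have "\<dots> = card (\<Union>C\<in>?P. ?M C)"
  proof (rule card_UN_disjoint[symmetric])
    show "\<forall>C\<in>?P. \<forall>D\<in>?P. C \<noteq> D \<longrightarrow> ?M C \<inter> ?M D = {}"
    proof (intro ballI impI)
      fix C D
      assume "C \<in> ?P" "D \<in> ?P" "C \<noteq> D"
      then have "C \<inter> D = {}"
        using quotient_disj[OF eq] by blast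
      moreover have "e \<noteq> {}" if "e \<in> M" for e
        using that mM G by (force simp: matching_def simple_graph_def)
      ultimately show "?M C \<inter> ?M D = {}"
        by blast
    qed
  qed (use finP finM in auto)
  also have "\<dots> \<le> card M"
    by (rule card_mono[OF finM]) blast
  finally show ?thesis
    using finP sub cover by blast
qed

text \<open>The hard inequality of the formula, with \<open>P\<close> in the role of the components
  left after deleting \<open>S\<close>. Induction on the number of vertices: a vertex covered by
  every maximum matching joins \<open>S\<close>, and its deletion lowers the matching number, which
  pays for the larger \<open>S\<close>. If there is no such vertex, the previous lemma applies with
  \<open>S\<close> empty.\<close>

lemma tutte_berge:
  assumes "simple_graph V E"
  shows "\<exists>M S P. matching E M \<and> finite S \<and> finite P \<and> (\<forall>C\<in>P. C \<subseteq> V)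
    \<and> (\<forall>e\<in>E. e \<inter> S = {} \<longrightarrow> (\<exists>C\<in>P. e \<subseteq> C))
    \<and> card S + (\<Sum>C\<in>P. card C div 2) \<le> card M"
  using assms
proof (induction "card V" arbitrary: V E rule: less_induct)
  case less
  note G = less.prems
  obtain M where M: "maximum_matching E M"
    using maximum_matching_exists[OF G] .
  show ?case
  proof (cases "\<exists>v\<in>V. \<forall>N. maximum_matching E N \<longrightarrow> v \<in> \<Union>N")
    case True
    then obtain v where v: "v \<in> V" "\<And>N. maximum_matching E N \<Longrightarrow> v \<in> \<Union>N"
      by blast
    let ?E = "{e \<in> E. v \<notin> e}"
    have "simple_graph (V - {v}) ?E"
      using G by (auto simp: simple_graph_def)
    have "card (V - {v}) < card V"
      using v simple_graph_finite(1)[OF G] by (meson card_Diff1_less)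
    from less.hyps[OF this \<open>simple_graph (V - {v}) ?E\<close>] obtain M' S P where *: "matching ?E M'" "finite S" "finite P"
      "\<forall>C\<in>P. C \<subseteq> V - {v}" "\<forall>e\<in>?E. e \<inter> S = {} \<longrightarrow> (\<exists>C\<in>P. e \<subseteq> C)"
      "card S + (\<Sum>C\<in>P. card C div 2) \<le> card M'"
      by (elim exE conjE) (rule that)
    have "matching E M'" "v \<notin> \<Union>M'"
      using *(1) by (auto simp: matching_def)
    then have "card M' < card M"
      using M v(2)[of M'] by (meson le_less_trans maximum_matching_def not_less order_trans)
    moreover have "card (insert v S) \<le> Suc (card S)"
      by (rule card_insert_le_m1) auto
    ultimately have "card (insert v S) + (\<Sum>C\<in>P. card C div 2) \<le> card M"
      using *(6) by linarith
    moreover have "\<forall>e\<in>E. e \<inter> insert v S = {} \<longrightarrow> (\<exists>C\<in>P. e \<subseteq> C)"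
      using *(5) by blast
    moreover have "\<forall>C\<in>P. C \<subseteq> V"
      using *(4) by blast
    moreover have "matching E M"
      using M by (simp add: maximum_matching_def)
    ultimately show ?thesis
      using *(2,3) by (metis finite_insert)
  next
    case False
    then have "\<exists>P. finite P \<and> (\<forall>C\<in>P. C \<subseteq> V) \<and> (\<forall>e\<in>E. \<exists>C\<in>P. e \<subseteq> C)
           \<and> (\<Sum>C\<in>P. card C div 2) \<le> card M"
      by (intro tutte_berge_all_missed[OF G M]) blast
    moreover have "matching E M"
      using M by (simp add: maximum_matching_def)
    ultimately show ?thesis
      by (metis add_0 card.empty finite.emptyI)
  qed
qed

section \<open>Separating two large sets\<close>

text \<open>\<open>J\<close> is the set of blocks that keep their part in \<open>X\<close> and lose their part in \<open>Y\<close>.\<close>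
definition balanced :: "('i \<Rightarrow> 'a set) \<Rightarrow> 'i set \<Rightarrow> 'a set \<Rightarrow> 'a set \<Rightarrow> 'i set \<Rightarrow> bool" where
  "balanced B I X Y J \<longleftrightarrow> J \<subseteq> I \<and> (\<forall>i\<in>J. card (B i \<inter> Y) \<le> card (B i) div 2)
     \<and> (\<forall>i\<in>I - J. card (B i \<inter> X) \<le> card (B i) div 2)"

lemma balanced_exists:
  assumes "\<And>i. i \<in> I \<Longrightarrow> finite (B i)" "X \<inter> Y = {}"
  obtains J where "balanced B I X Y J"
proof
  \<comment> \<open>A block with more than half of its vertices in \<open>Y\<close> has at most half
    of them in \<open>X\<close>, so it can afford to lose its part in \<open>X\<close>.\<close>
  let ?J = "{i \<in> I. card (B i \<inter> Y) \<le> card (B i) div 2}"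
  have "card (B i \<inter> X) + card (B i \<inter> Y) \<le> card (B i)" if "i \<in> I" for i
  proof -
    have "card (B i \<inter> X) + card (B i \<inter> Y) = card ((B i \<inter> X) \<union> (B i \<inter> Y))"
      using assms that by (subst card_Un_disjoint) auto
    also have "\<dots> \<le> card (B i)"
      using assms that by (intro card_mono) auto
    finally show ?thesis .
  qed
  then show "balanced B I X Y ?J"
    by (fastforce simp: balanced_def)
qed

text \<open>Serves to put a vertex aside: a choice of deleted halves stays admissible when a side
  loses a vertex.\<close>

lemma balanced_mono:
  assumes "balanced B I X Y J" "X' \<subseteq> X" "Y' \<subseteq> Y" "\<And>i. i \<in> I \<Longrightarrow> finite (B i)"
  shows "balanced B I X' Y' J"
proof -
  have "card (B i \<inter> X') \<le> card (B i \<inter> X)" "card (B i \<inter> Y') \<le> card (B i \<inter> Y)" if "i \<in> I" for i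
    using assms that by (auto intro!: card_mono)
  then show ?thesis
    using assms(1) unfolding balanced_def by (meson DiffD1 le_trans subsetD)
qed

text \<open>In the bound on \<open>card W\<close>, the sum pays for the halves deleted from all
  blocks, \<open>2 * s\<close> for the two sides, and \<open>m\<close> for the disturbance caused by
  switching the deleted half of one block. Without such a pair, the left side would stay below
  \<open>s\<close> even after all of \<open>W\<close> has moved to it.\<close>

lemma separated_large_sets:
  fixes B :: "'i \<Rightarrow> 'a set"
  assumes W: "finite W" and I: "finite I" and B: "\<And>i. i \<in> I \<Longrightarrow> finite (B i)"
    and m: "\<And>i. i \<in> I \<Longrightarrow> card (B i) div 2 \<le> m"
    and s: "s \<ge> 1"
    and large: "m + (\<Sum>i\<in>I. card (B i) div 2) + 2 * s \<le> card W"
  shows "\<exists>X Y. X \<subseteq> W \<and> Y \<subseteq> W \<and> X \<inter> Y = {} \<and> s \<le> card X \<and> s \<le> card Y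
           \<and> (\<forall>i\<in>I. B i \<inter> X = {} \<or> B i \<inter> Y = {})"
proof (rule ccontr)
  assume neg: "\<not> ?thesis"
  \<comment> \<open>\<open>L\<close> and \<open>R\<close> are what survives of the two sides after
    the deletions prescribed by \<open>J\<close>.\<close>
  define L where "L X J = X - (\<Union>i\<in>I - J. B i)" for X J
  define R where "R Y J = Y - (\<Union>i\<in>J. B i)" for Y J
  \<comment> \<open>The \<open>+ 1\<close> leaves room for a single vertex on neither side, the one
    being moved.\<close>
  define state where "state X Y J \<longleftrightarrow> X \<subseteq> W \<and> Y \<subseteq> W \<and> X \<inter> Y = {} \<and> card W \<le> card (X \<union> Y) + 1
    \<and> balanced B I X Y J" for X Y J
  have total: "m + 2 * s \<le> card (L X J) + card (R Y J) + 1" if "state X Y J" for X Y J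
  proof -
    let ?D = "\<Union>i\<in>I. if i \<in> J then B i \<inter> Y else B i \<inter> X"
    have st: "X \<subseteq> W" "Y \<subseteq> W" "X \<inter> Y = {}" "card W \<le> card (X \<union> Y) + 1" "balanced B I X Y J"
      using that by (auto simp: state_def)
    have fin: "finite (L X J)" "finite (R Y J)"
      using st W by (auto simp: L_def R_def intro!: finite_subset[of _ W])
    have "card ?D \<le> (\<Sum>i\<in>I. card (if i \<in> J then B i \<inter> Y else B i \<inter> X))"
      using I by (rule card_UN_le)
    also have "\<dots> \<le> (\<Sum>i\<in>I. card (B i) div 2)"
      using st(5) by (intro sum_mono) (auto simp: balanced_def)
    finally have D: "card ?D \<le> (\<Sum>i\<in>I. card (B i) div 2)" .
    have "X \<union> Y \<subseteq> L X J \<union> R Y J \<union> ?D"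
      using st(5) by (fastforce simp: L_def R_def balanced_def split: if_splits)
    moreover have "finite ?D"
      using I B by auto
    ultimately have "card (X \<union> Y) \<le> card (L X J \<union> R Y J \<union> ?D)"
      using fin by (intro card_mono) auto
    also have "\<dots> \<le> card (L X J) + card (R Y J) + card ?D"
      by (meson add_le_mono card_Un_le le_refl le_trans)
    finally show ?thesis
      using D st(4) large by linarith
  qed
  have one: "card (L X J) < s" if "state X Y J" "s \<le> card (R Y J)" for X Y J
  proof (rule ccontr)
    assume "\<not> ?thesis"
    moreover have "\<forall>i\<in>I. B i \<inter> L X J = {} \<or> B i \<inter> R Y J = {}"
      by (auto simp: L_def R_def)
    moreover have "L X J \<subseteq> W" "R Y J \<subseteq> W" "L X J \<inter> R Y J = {}"
      using that(1) by (auto simp: state_def L_def R_def)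
    ultimately show False
      using neg that(2) by (meson not_less)
  qed
  \<comment> \<open>While the left side is small, \<open>total\<close> gives the right side at least
    \<open>m + s\<close> vertices. Switching block \<open>i\<close> removes at most \<open>m\<close>
    of them, so at least \<open>s\<close> remain and \<open>one\<close> keeps the left side
    small.\<close>
  have flip: "card (L X K) < s" if J: "state X Y J" "card (L X J) < s" and K: "state X Y K" and
    i: "J - {i} \<subseteq> K" "K \<subseteq> insert i J" for X Y J K i
  proof -
    have bigR: "m + s \<le> card (R Y J)"
      using total[OF J(1)] J(2) by linarith
    have finY: "finite Y"
      using J(1) W finite_subset by (auto simp: state_def)
    have "s \<le> card (R Y K)"
    proof (cases "i \<in> K")
      case True
      then have "i \<in> I" "card (B i \<inter> Y) \<le> card (B i) div 2"
        using K by (auto simp: state_def balanced_def)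
      then have Bm: "card (B i \<inter> Y) \<le> m"
        using m le_trans by blast
      have "R Y J \<subseteq> R Y K \<union> (B i \<inter> Y)"
        using i by (auto simp: R_def)
      then have "card (R Y J) \<le> card (R Y K \<union> (B i \<inter> Y))"
        using finY by (intro card_mono) (auto simp: R_def)
      also have "\<dots> \<le> card (R Y K) + card (B i \<inter> Y)"
        by (rule card_Un_le)
      finally show ?thesis
        using bigR Bm by linarith
    next
      case False
      then have "R Y J \<subseteq> R Y K"
        using i by (auto simp: R_def)
      then have "card (R Y J) \<le> card (R Y K)"
        using finY by (intro card_mono) (auto simp: R_def)
      then show ?thesis
        using bigR by linarith
    qed
    then show ?thesis
      using one[OF K] by blast
  qed
  have indep: "card (L X K) < s" if J: "state X Y J" "card (L X J) < s" and K: "state X Y K" for X Y J K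
  proof -
    \<comment> \<open>\<open>?H A\<close> follows \<open>K\<close> on the blocks in \<open>A\<close>
      and \<open>J\<close> elsewhere, so enlarging \<open>A\<close> turns \<open>J\<close> into
      \<open>K\<close> by single flips. Every such hybrid is admissible because
      \<open>balanced\<close> is a condition on each block separately.\<close>
    let ?H = "\<lambda>A. (J - A) \<union> (K \<inter> A)"
    have st: "state X Y (?H A)" for A
      using J(1) K by (auto simp: state_def balanced_def)
    have "card (L X (?H A)) < s" if "finite A" for A
      using that
    proof induction
      case empty
      then show ?case using J by simp
    next
      case (insert i A)
      show ?case
        by (rule flip[OF st insert.IH st, of i]) auto
    qed
    from this[OF I] show ?thesis
      using J(1) K by (simp add: state_def balanced_def Diff_eq_empty_iff[THEN iffD2] Int_absorb2)
  qed
  have bal: "\<exists>J. balanced B I X (W - X) J" for X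
    using balanced_exists[of I B X "W - X"] B by (metis Diff_disjoint)
  have all: "\<forall>J. state X (W - X) J \<longrightarrow> card (L X J) < s" if "finite X" "X \<subseteq> W" for X
    using that
  proof (induction rule: finite_induct)
    case empty
    then show ?case using s by (simp add: L_def)
  next
    case (insert v X)
    let ?Y = "W - insert v X"
    show ?case
    proof (intro allI impI)
      fix K
      assume K: "state (insert v X) ?Y K"
      obtain J where J: "balanced B I X (W - X) J"
        using bal by blast
      have un: "X \<union> (W - X) = W" "insert v (X \<union> ?Y) = W"
        using insert.prems by auto
      \<comment> \<open>With \<open>v\<close> on neither side, the old choice \<open>J\<close> and
        the new choice \<open>K\<close> are both admissible, and \<open>indep\<close> passes from
        one to the other.\<close>
      have "card W \<le> card (X \<union> ?Y) + 1"
        using card_insert_le_m1[of "card (X \<union> ?Y) + 1" "X \<union> ?Y" v] un by simp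
      moreover have "balanced B I X ?Y J" "balanced B I X ?Y K"
        using J K B by (auto intro: balanced_mono simp: state_def)
      ultimately have mid: "state X ?Y J" "state X ?Y K"
        using insert.prems by (auto simp: state_def)
      have "state X (W - X) J"
        using J insert.prems un by (auto simp: state_def)
      then have "card (L X J) < s"
        using insert by blast
      then have "card (L X K) < s"
        using indep mid by blast
      \<comment> \<open>\<open>R\<close> does not depend on the left side, so this bound survives
        when \<open>v\<close> joins it.\<close>
      then have "s \<le> card (R ?Y K)"
        using total[OF mid(2)] by linarith
      then show "card (L (insert v X) K) < s"
        using one[OF K] by blast
    qed
  qed
  \<comment> \<open>With all of \<open>W\<close> on the left, \<open>R\<close> is empty, and
    \<open>total\<close> would force \<open>m + 2 * s\<close> \<le> \<open>s\<close>.\<close>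
  obtain J where "balanced B I W (W - W) J"
    using bal by blast
  then have st: "state W (W - W) J"
    by (auto simp: state_def)
  then have "card (L W J) < s"
    using all W by blast
  then show False
    using total[OF st] s by (simp add: R_def)
qed

section \<open>Monochromatic matchings in connectors\<close>

theorem theorem1p1:
  fixes q s n :: nat and t :: "nat \<Rightarrow> nat" and V :: "'a set" and E :: "'a set set"
  assumes "q \<ge> 1" and "s \<ge> 1"
    and "\<And>i. i \<in> {1..q} \<Longrightarrow> t i \<ge> 1"
    and "n \<ge> max_norm q t + Lambda q t + 1 + 7 * (q + 1) * (s - 1)"
    and "simple_graph V E" and "card V = n"
    and "connector s V E"
  shows "arrows_matchings E q t"
  unfolding arrows_matchings_def
proof (intro allI impI, rule ccontr)
  fix c
  assume c: "edge_colouring q E c"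
    and neg: "\<not> (\<exists>j\<in>{1..q}. \<exists>M. matching E M \<and> card M = t j \<and> (\<forall>e\<in>M. c e = j))"
  have finV: "finite V"
    using simple_graph_finite(1)[OF assms(5)] .
  \<comment> \<open>Tutte-Berge for the graph of colour \<open>j\<close>: its matching has fewer
    than \<open>t j\<close> edges, since otherwise a subset of it would contradict
    \<open>neg\<close>.\<close>
  have "\<exists>S P. finite S \<and> finite P \<and> (\<forall>C\<in>P. C \<subseteq> V)
    \<and> (\<forall>e\<in>E. c e = j \<longrightarrow> e \<inter> S = {} \<longrightarrow> (\<exists>C\<in>P. e \<subseteq> C))
    \<and> card S + (\<Sum>C\<in>P. card C div 2) \<le> t j - 1" if j: "j \<in> {1..q}" for j
  proof -
    let ?E = "{e \<in> E. c e = j}"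
    have "simple_graph V ?E"
      using assms(5) by (auto simp: simple_graph_def)
    from tutte_berge[OF this] obtain M S P where *: "matching ?E M" "finite S" "finite P" "\<forall>C\<in>P. C \<subseteq> V"
      "\<forall>e\<in>?E. e \<inter> S = {} \<longrightarrow> (\<exists>C\<in>P. e \<subseteq> C)" "card S + (\<Sum>C\<in>P. card C div 2) \<le> card M"
      by (elim exE conjE) (rule that)
    have "card M < t j"
    proof (rule ccontr)
      assume "\<not> ?thesis"
      then obtain N where N: "N \<subseteq> M" "card N = t j"
        using obtain_subset_with_card_n[of "t j" M] by auto
      then have "matching E N" "\<forall>e\<in>N. c e = j"
        using matching_subset[OF *(1) N(1)] by (auto simp: matching_def)
      then show False
        using neg j N(2) by blast
    qed
    then have "card S + (\<Sum>C\<in>P. card C div 2) \<le> t j - 1"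
      using *(6) by linarith
    then show ?thesis
      using *(2-5) by blast
  qed
  then have "\<exists>S. \<forall>j\<in>{1..q}. \<exists>P. finite (S j) \<and> finite P \<and> (\<forall>C\<in>P. C \<subseteq> V)
    \<and> (\<forall>e\<in>E. c e = j \<longrightarrow> e \<inter> S j = {} \<longrightarrow> (\<exists>C\<in>P. e \<subseteq> C))
    \<and> card (S j) + (\<Sum>C\<in>P. card C div 2) \<le> t j - 1"
    by (intro bchoice) blast
  then obtain S where "\<forall>j\<in>{1..q}. \<exists>P. finite (S j) \<and> finite P \<and> (\<forall>C\<in>P. C \<subseteq> V)
    \<and> (\<forall>e\<in>E. c e = j \<longrightarrow> e \<inter> S j = {} \<longrightarrow> (\<exists>C\<in>P. e \<subseteq> C))
    \<and> card (S j) + (\<Sum>C\<in>P. card C div 2) \<le> t j - 1"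
    by (elim exE) (rule that)
  from bchoice[OF this] obtain P where
    P: "\<forall>j\<in>{1..q}. finite (S j) \<and> finite (P j) \<and> (\<forall>C\<in>P j. C \<subseteq> V)
      \<and> (\<forall>e\<in>E. c e = j \<longrightarrow> e \<inter> S j = {} \<longrightarrow> (\<exists>C\<in>P j. e \<subseteq> C))
      \<and> card (S j) + (\<Sum>C\<in>P j. card C div 2) \<le> t j - 1"
    by (elim exE) (rule that)
  have fin: "finite (S j) \<and> finite (P j)"
    and sub: "\<And>C. C \<in> P j \<Longrightarrow> C \<subseteq> V"
    and cover: "\<And>e. e \<in> E \<Longrightarrow> c e = j \<Longrightarrow> e \<inter> S j = {} \<Longrightarrow> \<exists>C\<in>P j. e \<subseteq> C"
    and small: "card (S j) + (\<Sum>C\<in>P j. card C div 2) \<le> t j - 1"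
    if "j \<in> {1..q}" for j
    using bspec[OF P that] by simp_all
  define W where "W = V - (\<Union>j\<in>{1..q}. S j)"
  \<comment> \<open>Pairs are used as indices because the same set may be a block for several
    colours, and each occurrence is charged to its own colour.\<close>
  define I where "I = Sigma {1..q} P"
  define B where "B p = snd p \<inter> W" for p :: "nat \<times> 'a set"
  \<comment> \<open>Half of a block of colour \<open>j\<close> has at most \<open>t j - 1\<close>
    vertices, whence this value.\<close>
  define m where "m = max_norm q t - 1"
  have finI: "finite I"
    using fin by (auto simp: I_def)
  have finB: "finite (B p)" for p
    using finV by (simp add: B_def W_def)
  have max: "t j \<le> max_norm q t" if "j \<in> {1..q}" for j
    using that by (simp add: max_norm_def)
  have max1: "1 \<le> max_norm q t"
    using max[of 1] assms(1) assms(3)[of 1] by simp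
  have shrink: "card (B (j, C)) div 2 \<le> card C div 2" if "j \<in> {1..q}" "C \<in> P j" for j C
    using that sub finV by (intro div_le_mono card_mono) (auto simp: B_def intro: finite_subset)
  have "(\<Sum>p\<in>I. card (B p) div 2) \<le> (\<Sum>(j, C)\<in>I. card C div 2)"
    using shrink by (intro sum_mono) (auto simp: I_def)
  also have "\<dots> = (\<Sum>j\<in>{1..q}. \<Sum>C\<in>P j. card C div 2)"
    using fin by (simp add: I_def sum.Sigma)
  finally have sumB: "(\<Sum>p\<in>I. card (B p) div 2) \<le> (\<Sum>j\<in>{1..q}. \<Sum>C\<in>P j. card C div 2)" .
  have "(\<Sum>j\<in>{1..q}. card (S j) + (\<Sum>C\<in>P j. card C div 2)) \<le> Lambda q t"
    unfolding Lambda_def using small by (rule sum_mono)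
  then have "(\<Sum>j\<in>{1..q}. card (S j)) + (\<Sum>p\<in>I. card (B p) div 2) \<le> Lambda q t"
    using sumB by (simp add: sum.distrib)
  moreover have "card (\<Union>j\<in>{1..q}. S j) \<le> (\<Sum>j\<in>{1..q}. card (S j))"
    by (intro card_UN_le) simp
  moreover have "card V \<le> card W + card (\<Union>j\<in>{1..q}. S j)"
    using diff_card_le_card_Diff[of "\<Union>j\<in>{1..q}. S j" V] fin by (simp add: W_def)
  \<comment> \<open>With \<open>7 * (q + 1)\<close> bounded below by 2, the hypothesis on
    \<open>n\<close> gives \<open>n\<close> \<ge> \<open>m + Lambda q t + 2 * s\<close>, where
    \<open>Lambda q t\<close> pays for the sets \<open>S j\<close> and the deleted halves
    together.\<close>
  moreover have "2 * (s - 1) \<le> 7 * (q + 1) * (s - 1)"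
    by (rule mult_right_mono) auto
  ultimately have large: "m + (\<Sum>p\<in>I. card (B p) div 2) + 2 * s \<le> card W"
    using assms(2,4,6) max1 unfolding m_def by linarith
  have Bm: "card (B p) div 2 \<le> m" if pI: "p \<in> I" for p
  proof -
    obtain j C where p: "p = (j, C)" "j \<in> {1..q}" "C \<in> P j"
      using pI by (auto simp: I_def)
    have "card C div 2 \<le> (\<Sum>C\<in>P j. card C div 2)"
      using p fin by (intro member_le_sum) auto
    then show ?thesis
      using shrink[OF p(2,3)] small[OF p(2)] max[OF p(2)] unfolding m_def p(1) by linarith
  qed
  have "finite W"
    using finV by (simp add: W_def)
  from separated_large_sets[OF this finI finB Bm assms(2) large] obtain X Y where XY: "X \<subseteq> W" "Y \<subseteq> W" "X \<inter> Y = {}" "s \<le> card X" "s \<le> card Y"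
    and sep: "\<And>p. p \<in> I \<Longrightarrow> B p \<inter> X = {} \<or> B p \<inter> Y = {}"
    by blast
  have "W \<subseteq> V"
    by (auto simp: W_def)
  then obtain x y where xy: "x \<in> X" "y \<in> Y" "{x, y} \<in> E"
    using assms(7) XY unfolding connector_def by (meson subset_trans)
  \<comment> \<open>The edge avoids \<open>S j\<close>, so it lies in a block of its colour; that
    block then meets both \<open>X\<close> and \<open>Y\<close>, against \<open>sep\<close>.\<close>
  define j where "j = c {x, y}"
  have j: "j \<in> {1..q}"
    using c xy by (simp add: edge_colouring_def j_def)
  have "{x, y} \<inter> S j = {}"
    using xy XY j by (auto simp: W_def)
  then obtain C where "C \<in> P j" "{x, y} \<subseteq> C"
    using cover[OF j xy(3)] j_def by blast
  then show False
    using sep[of "(j, C)"] j xy XY by (auto simp: I_def B_def)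
qed

end
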